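(* Let $(M_n,g)$ be a Riemannian manifold, let $a$ be a symmetric tensor field of type $(0,2)$ on $M_n$, and equip the tangent bundle $T(M_n)$ with the synectic metric ${}^{S}g={}^{C}g+{}^{V}a$. Let $X$ be a vector field on $M_n$. Then the vertical lift ${}^{V}X$ is a harmonic vector field on $(T(M_n),{}^{S}g)$ if and only if $X$ is a closed vector field on $(M_n,g)$.
   Context: $M_n$ is a smooth manifold of dimension $n$ and all tensor fields are smooth. For local coordinates $(x^h)$ on $U\subset M_n$, the induced coordinates on $\pi^{-1}(U)\subset T(M_n)$ are $(x^h,y^h)$, where $y^h$ are the components of a tangent vector. The synectic metric ${}^{S}g={}^{C}g+{}^{V}a$ (the complete lift of $g$ plus the vertical lift of $a$) is the (pseudo-Riemannian) metric on $T(M_n)$ with component matrix, in induced coordinates, $$\begin{pmatrix} a_{ji}+y^{s}\partial_s g_{ji} & g_{ji}\\ g_{ji} & 0\end{pmatrix}.$$ For a vector field $X$ on $M_n$ with components $X^h$, the vertical lift ${}^{V}X$ has components $(0,\,X^h)$ in the induced coordinates. Given a (pseudo-)Riemannian metric $G$ with Levi-Civita connection $D$, and a vector field $Z$, the associated covector field $Z^*$ is given by $Z^*(W)=G(Z,W)$, with components $Z_C=G_{CA}Z^A$. The vector field $Z$ is called closed if $Z^*$ is closed, i.e. $D_BZ_A-D_AZ_B=0$, and harmonic if it is closed and in addition $G^{BA}D_BZ_A=0$ (the divergence of $Z$ vanishes). *)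

theory Defs
  imports "HOL-Analysis.Analysis"
begin

section \<open>Smooth functions of several real variables\<close>

definition partial :: "'n::finite \<Rightarrow> (real^'n \<Rightarrow> real) \<Rightarrow> real^'n \<Rightarrow> real" where
  "partial k f x = deriv (\<lambda>t. f (x + t *\<^sub>R axis k 1)) 0"

text \<open>Only used for open sets \<open>S\<close>.\<close>

primrec Ck_on :: "nat \<Rightarrow> (real^'n::finite) set \<Rightarrow> (real^'n \<Rightarrow> real) \<Rightarrow> bool" where
  "Ck_on 0 S f \<longleftrightarrow> continuous_on S f"
| "Ck_on (Suc r) S f \<longleftrightarrow> f differentiable_on S \<and> (\<forall>k. Ck_on r S (partial k f))"

definition smooth_on :: "(real^'n::finite) set \<Rightarrow> (real^'n \<Rightarrow> real) \<Rightarrow> bool" where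
  "smooth_on S f \<longleftrightarrow> (\<forall>r. Ck_on r S f)"


section \<open>Smooth manifolds\<close>

text \<open>
  A manifold of dimension \<open>CARD('n)\<close> is a topological space with an atlas, given as a family of
  charts \<open>chart M i : chart_dom M i \<rightarrow> real^'n\<close>, where \<open>i\<close> ranges over \<open>indices M\<close>.
\<close>

record ('i, 'a, 'n) manifold =
  mtop :: "'a topology"
  indices :: "'i set"
  chart_dom :: "'i \<Rightarrow> 'a set"
  chart :: "'i \<Rightarrow> 'a \<Rightarrow> real^('n::finite)"

definition chart_image :: "('i, 'a, 'n::finite) manifold \<Rightarrow> 'i \<Rightarrow> (real^'n) set" where
  "chart_image M i = chart M i ` chart_dom M i"

definition transition ::
    "('i, 'a, 'n::finite) manifold \<Rightarrow> 'i \<Rightarrow> 'i \<Rightarrow> real^'n \<Rightarrow> real^'n" where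
  "transition M i j x = chart M j (inv_into (chart_dom M i) (chart M i) x)"

definition smooth_manifold :: "('i, 'a, 'n::finite) manifold \<Rightarrow> bool" where
  "smooth_manifold M \<longleftrightarrow>
     Hausdorff_space (mtop M) \<and> second_countable (mtop M) \<and>
     topspace (mtop M) = (\<Union>i\<in>indices M. chart_dom M i) \<and>
     (\<forall>i\<in>indices M.
        openin (mtop M) (chart_dom M i) \<and> open (chart_image M i) \<and>
        homeomorphic_map (subtopology (mtop M) (chart_dom M i))
          (top_of_set (chart_image M i)) (chart M i)) \<and>
     (\<forall>i\<in>indices M. \<forall>j\<in>indices M. \<forall>h.
        smooth_on (chart M i ` (chart_dom M i \<inter> chart_dom M j)) (\<lambda>x. transition M i j x $ h))"

definition jacobian ::
    "('i, 'a, 'n::finite) manifold \<Rightarrow> 'i \<Rightarrow> 'i \<Rightarrow> real^'n \<Rightarrow> real^'n^'n" where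
  "jacobian M i j x = (\<chi> h k. partial k (\<lambda>x. transition M i j x $ h) x)"


section \<open>Tensor fields\<close>

text \<open>
  Tensor fields are families of component functions in the local coordinates of the charts, related
  by the tensorial transformation law on overlaps. The values of \<open>X i\<close> and \<open>t i\<close> outside
  \<open>chart_image M i\<close> are irrelevant.
\<close>

type_synonym ('i, 'n) vfield = "'i \<Rightarrow> real^'n \<Rightarrow> real^'n"
type_synonym ('i, 'n) cov2field = "'i \<Rightarrow> real^'n \<Rightarrow> real^'n^'n"

definition vector_field :: "('i, 'a, 'n::finite) manifold \<Rightarrow> ('i, 'n) vfield \<Rightarrow> bool" where
  "vector_field M X \<longleftrightarrow>
     (\<forall>i\<in>indices M. \<forall>h. smooth_on (chart_image M i) (\<lambda>x. X i x $ h)) \<and>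
     (\<forall>i\<in>indices M. \<forall>j\<in>indices M. \<forall>p\<in>chart_dom M i \<inter> chart_dom M j.
        X j (chart M j p) = jacobian M i j (chart M i p) *v X i (chart M i p))"

definition cov2_tensor_field ::
    "('i, 'a, 'n::finite) manifold \<Rightarrow> ('i, 'n) cov2field \<Rightarrow> bool" where
  "cov2_tensor_field M t \<longleftrightarrow>
     (\<forall>i\<in>indices M. \<forall>h k. smooth_on (chart_image M i) (\<lambda>x. t i x $ h $ k)) \<and>
     (\<forall>i\<in>indices M. \<forall>j\<in>indices M. \<forall>p\<in>chart_dom M i \<inter> chart_dom M j.
        t i (chart M i p) =
          transpose (jacobian M i j (chart M i p)) ** t j (chart M j p)
            ** jacobian M i j (chart M i p))"

definition symmetric_cov2 ::
    "('i, 'a, 'n::finite) manifold \<Rightarrow> ('i, 'n) cov2field \<Rightarrow> bool" where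
  "symmetric_cov2 M t \<longleftrightarrow>
     (\<forall>i\<in>indices M. \<forall>x\<in>chart_image M i. transpose (t i x) = t i x)"

definition riemannian_metric ::
    "('i, 'a, 'n::finite) manifold \<Rightarrow> ('i, 'n) cov2field \<Rightarrow> bool" where
  "riemannian_metric M g \<longleftrightarrow>
     cov2_tensor_field M g \<and> symmetric_cov2 M g \<and>
     (\<forall>i\<in>indices M. \<forall>x\<in>chart_image M i. \<forall>v. v \<noteq> 0 \<longrightarrow> v \<bullet> (g i x *v v) > 0)"


section \<open>The Levi-Civita connection\<close>

text \<open>
  The coefficient \<open>\<Gamma> $ h $ j $ i\<close> is $\Gamma^h_{ji}$. The two conditions say that the connection is
  torsion-free and that the covariant derivative of the metric vanishes at \<open>x\<close>; they have a unique
  solution where the metric is non-degenerate, see \<open>levi_civita_eq\<close> below.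
\<close>

definition is_levi_civita ::
    "(real^'n::finite \<Rightarrow> real^'n^'n) \<Rightarrow> real^'n \<Rightarrow> real^'n^'n^'n \<Rightarrow> bool" where
  "is_levi_civita G x \<Gamma> \<longleftrightarrow>
     (\<forall>h j i. \<Gamma> $ h $ j $ i = \<Gamma> $ h $ i $ j) \<and>
     (\<forall>k j i. partial k (\<lambda>x. G x $ j $ i) x
        - (\<Sum>l\<in>UNIV. \<Gamma> $ l $ k $ j * G x $ l $ i)
        - (\<Sum>l\<in>UNIV. \<Gamma> $ l $ k $ i * G x $ j $ l) = 0)"

definition levi_civita ::
    "(real^'n::finite \<Rightarrow> real^'n^'n) \<Rightarrow> real^'n \<Rightarrow> real^'n^'n^'n" where
  "levi_civita G x = (THE \<Gamma>. is_levi_civita G x \<Gamma>)"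

definition christoffel ::
    "(real^'n::finite \<Rightarrow> real^'n^'n) \<Rightarrow> real^'n \<Rightarrow> real^'n^'n^'n" where
  "christoffel G x = (\<chi> h j i. 1 / 2 * (\<Sum>l\<in>UNIV. matrix_inv (G x) $ h $ l *
     (partial j (\<lambda>x. G x $ i $ l) x + partial i (\<lambda>x. G x $ j $ l) x
        - partial l (\<lambda>x. G x $ j $ i) x)))"

lemma partial_cong:
  fixes f f' :: "real^'n::finite \<Rightarrow> real"
  assumes "open S" "x \<in> S" "\<And>y. y \<in> S \<Longrightarrow> f y = f' y"
  shows "partial k f x = partial k f' x"
proof -
  have "((\<lambda>t. x + t *\<^sub>R axis k (1::real)) \<longlongrightarrow> x + 0 *\<^sub>R axis k 1) (nhds (0::real))"
    by (intro tendsto_intros filterlim_ident)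
  then have "\<forall>\<^sub>F t in nhds 0. x + t *\<^sub>R axis k (1::real) \<in> S"
    using assms(1,2) by (intro topological_tendstoD) auto
  then have "\<forall>\<^sub>F t in nhds 0. f (x + t *\<^sub>R axis k 1) = f' (x + t *\<^sub>R axis k 1)"
    by (rule eventually_mono) (use assms(3) in auto)
  then show ?thesis
    unfolding partial_def by (intro deriv_cong_ev) auto
qed

lemma levi_civita_eq:
  fixes G :: "real^'n::finite \<Rightarrow> real^'n^'n"
  assumes S: "open S" "x \<in> S" and symS: "\<And>y. y \<in> S \<Longrightarrow> transpose (G y) = G y"
    and inv: "invertible (G x)"
  shows "is_levi_civita G x \<Gamma> \<longleftrightarrow> \<Gamma> = christoffel G x"
    and "levi_civita G x = christoffel G x"
proof -
  define H where "H = matrix_inv (G x)"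
  define P where "P k j i = partial k (\<lambda>x. G x $ j $ i) x" for k j i
  have ent: "G y $ j $ i = G y $ i $ j" if "y \<in> S" for y j i
    using symS[OF that] by (metis transpose_def vec_lambda_beta)
  have Psym: "P k j i = P k i j" for k j i
    unfolding P_def by (rule partial_cong[OF S]) (rule ent)
  have Gsym: "G x $ j $ i = G x $ i $ j" for j i
    using ent S(2) by auto
  have HG: "H ** G x = mat 1" and GH: "G x ** H = mat 1"
    using someI_ex[OF inv[unfolded invertible_def]] unfolding H_def matrix_inv_def by blast+
  have HGe: "(\<Sum>l\<in>UNIV. H $ h $ l * G x $ l $ i) = (if h = i then 1 else 0)" for h i
    using arg_cong[OF HG, of "\<lambda>A. A $ h $ i"] by (simp add: matrix_matrix_mult_def mat_def)
  have GHe: "(\<Sum>l\<in>UNIV. G x $ h $ l * H $ l $ i) = (if h = i then 1 else 0)" for h i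
    using arg_cong[OF GH, of "\<lambda>A. A $ h $ i"] by (simp add: matrix_matrix_mult_def mat_def)
  define C where "C = christoffel G x"
  have C_eq: "C $ h $ j $ i = 1 / 2 * (\<Sum>l\<in>UNIV. H $ h $ l * (P j i l + P i j l - P l j i))"
    for h j i by (simp add: C_def christoffel_def H_def P_def)
  have C_low: "(\<Sum>l\<in>UNIV. G x $ m $ l * C $ l $ j $ i) = 1 / 2 * (P j i m + P i j m - P m j i)"
    for m j i
  proof -
    have "(\<Sum>l\<in>UNIV. G x $ m $ l * C $ l $ j $ i)
        = 1 / 2 * (\<Sum>l\<in>UNIV. \<Sum>r\<in>UNIV. G x $ m $ l * H $ l $ r * (P j i r + P i j r - P r j i))"
      by (simp add: C_eq sum_distrib_left mult_ac)
    also have "\<dots> = 1 / 2 * (\<Sum>r\<in>UNIV. (\<Sum>l\<in>UNIV. G x $ m $ l * H $ l $ r)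
        * (P j i r + P i j r - P r j i))"
      by (subst sum.swap) (simp add: sum_distrib_right)
    also have "\<dots> = 1 / 2 * (P j i m + P i j m - P m j i)"
      by (simp add: GHe if_distrib[of "\<lambda>u. u * _"] cong: if_cong)
    finally show ?thesis .
  qed
  have C_ok: "is_levi_civita G x C"
    unfolding is_levi_civita_def
  proof (intro conjI allI)
    fix h j i show "C $ h $ j $ i = C $ h $ i $ j"
      unfolding C_eq using Psym by (simp add: add.commute)
  next
    fix k j i
    have 1: "(\<Sum>l\<in>UNIV. C $ l $ k $ j * G x $ l $ i) = 1 / 2 * (P k j i + P j k i - P i k j)"
      using C_low[of i k j] Gsym by (simp add: mult.commute)
    have 2: "(\<Sum>l\<in>UNIV. C $ l $ k $ i * G x $ j $ l) = 1 / 2 * (P k i j + P i k j - P j k i)"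
      using C_low[of j k i] by (simp add: mult.commute)
    show "partial k (\<lambda>x. G x $ j $ i) x - (\<Sum>l\<in>UNIV. C $ l $ k $ j * G x $ l $ i)
        - (\<Sum>l\<in>UNIV. C $ l $ k $ i * G x $ j $ l) = 0"
      unfolding 1 2 P_def[symmetric] using Psym[of k j i] by (simp add: field_simps)
  qed
  have uniq: "\<Gamma> = C" if lc: "is_levi_civita G x \<Gamma>" for \<Gamma>
  proof -
    define L where "L m j i = (\<Sum>l\<in>UNIV. G x $ m $ l * \<Gamma> $ l $ j $ i)" for m j i
    have Lsym: "L m j i = L m i j" for m j i
      using lc unfolding L_def is_levi_civita_def by metis
    have PL: "P k j i = L i k j + L j k i" for k j i
    proof -
      have "P k j i - (\<Sum>l\<in>UNIV. \<Gamma> $ l $ k $ j * G x $ l $ i)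
          - (\<Sum>l\<in>UNIV. \<Gamma> $ l $ k $ i * G x $ j $ l) = 0"
        using lc unfolding P_def is_levi_civita_def by blast
      moreover have "(\<Sum>l\<in>UNIV. \<Gamma> $ l $ k $ j * G x $ l $ i) = L i k j"
        unfolding L_def using Gsym by (intro sum.cong) (auto simp: mult.commute)
      moreover have "(\<Sum>l\<in>UNIV. \<Gamma> $ l $ k $ i * G x $ j $ l) = L j k i"
        unfolding L_def by (intro sum.cong) (auto simp: mult.commute)
      ultimately show ?thesis by simp
    qed
    have L_eq: "L m j i = 1 / 2 * (P j i m + P i j m - P m j i)" for m j i
      unfolding PL using Lsym[of m j i] Lsym[of j i m] Lsym[of i j m] by simp
    have "\<Gamma> $ h $ j $ i = C $ h $ j $ i" for h j i
    proof -
      have "C $ h $ j $ i = (\<Sum>m\<in>UNIV. H $ h $ m * L m j i)"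
        unfolding C_eq L_eq by (simp add: sum_distrib_left)
      also have "\<dots> = (\<Sum>m\<in>UNIV. \<Sum>l\<in>UNIV. H $ h $ m * G x $ m $ l * \<Gamma> $ l $ j $ i)"
        by (simp add: L_def sum_distrib_left mult.assoc)
      also have "\<dots> = (\<Sum>l\<in>UNIV. (\<Sum>m\<in>UNIV. H $ h $ m * G x $ m $ l) * \<Gamma> $ l $ j $ i)"
        by (subst sum.swap) (simp add: sum_distrib_right)
      also have "\<dots> = \<Gamma> $ h $ j $ i"
        by (simp add: HGe if_distrib[of "\<lambda>u. u * _"] cong: if_cong)
      finally show ?thesis by simp
    qed
    then show ?thesis by (simp add: vec_eq_iff)
  qed
  show "is_levi_civita G x \<Gamma> \<longleftrightarrow> \<Gamma> = christoffel G x"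
    using C_ok uniq unfolding C_def by blast
  show "levi_civita G x = christoffel G x"
    unfolding levi_civita_def C_def[symmetric] using C_ok uniq by (rule the_equality)
qed

definition cov_deriv_covector ::
    "(real^'n::finite \<Rightarrow> real^'n^'n) \<Rightarrow> (real^'n \<Rightarrow> real^'n) \<Rightarrow> 'n \<Rightarrow> 'n \<Rightarrow> real^'n \<Rightarrow> real"
  where
  "cov_deriv_covector G w b a x =
     partial b (\<lambda>x. w x $ a) x - (\<Sum>c\<in>UNIV. levi_civita G x $ c $ b $ a * w x $ c)"


section \<open>Closed and harmonic vector fields\<close>

definition lower ::
    "(real^'n::finite \<Rightarrow> real^'n^'n) \<Rightarrow> (real^'n \<Rightarrow> real^'n) \<Rightarrow> real^'n \<Rightarrow> real^'n" where
  "lower G Z x = G x *v Z x"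

definition closed_vector_field ::
    "('i, 'a, 'n::finite) manifold \<Rightarrow> ('i, 'n) cov2field \<Rightarrow> ('i, 'n) vfield \<Rightarrow> bool" where
  "closed_vector_field M G Z \<longleftrightarrow>
     (\<forall>i\<in>indices M. \<forall>x\<in>chart_image M i. \<forall>a b.
        cov_deriv_covector (G i) (lower (G i) (Z i)) b a x
        - cov_deriv_covector (G i) (lower (G i) (Z i)) a b x = 0)"

definition harmonic_vector_field ::
    "('i, 'a, 'n::finite) manifold \<Rightarrow> ('i, 'n) cov2field \<Rightarrow> ('i, 'n) vfield \<Rightarrow> bool" where
  "harmonic_vector_field M G Z \<longleftrightarrow>
     closed_vector_field M G Z \<and>
     (\<forall>i\<in>indices M. \<forall>x\<in>chart_image M i.
        (\<Sum>b\<in>UNIV. \<Sum>a\<in>UNIV. matrix_inv (G i x) $ b $ a *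
           cov_deriv_covector (G i) (lower (G i) (Z i)) b a x) = 0)"


section \<open>The tangent bundle\<close>

text \<open>
  A tangent vector at \<open>p\<close> is the family \<open>\<xi>\<close> of its components in the charts around \<open>p\<close>;
  it is set to \<open>0\<close> at the other indices so that vectors are equal iff their components are.
\<close>

definition tangent_space ::
    "('i, 'a, 'n::finite) manifold \<Rightarrow> 'a \<Rightarrow> ('i \<Rightarrow> real^'n) set" where
  "tangent_space M p =
     {\<xi>. (\<forall>i\<in>indices M. \<forall>j\<in>indices M. p \<in> chart_dom M i \<inter> chart_dom M j \<longrightarrow>
            \<xi> j = jacobian M i j (chart M i p) *v \<xi> i) \<and>
         (\<forall>i. \<not> (i \<in> indices M \<and> p \<in> chart_dom M i) \<longrightarrow> \<xi> i = 0)}"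

text \<open>
  The coordinates \<open>(x^h, y^h)\<close> are indexed by the sum type \<open>'n + 'n\<close>: \<open>Inl h\<close> for \<open>x^h\<close> and
  \<open>Inr h\<close> for \<open>y^h\<close>.
\<close>

definition join :: "real^'n::finite \<Rightarrow> real^'n \<Rightarrow> real^('n + 'n)" where
  "join x y = (\<chi> k. case k of Inl h \<Rightarrow> x $ h | Inr h \<Rightarrow> y $ h)"

definition base_part :: "real^('n::finite + 'n) \<Rightarrow> real^'n" where
  "base_part z = (\<chi> h. z $ Inl h)"

definition fibre_part :: "real^('n::finite + 'n) \<Rightarrow> real^'n" where
  "fibre_part z = (\<chi> h. z $ Inr h)"

definition bundle_dom ::
    "('i, 'a, 'n::finite) manifold \<Rightarrow> 'i \<Rightarrow> ('a \<times> ('i \<Rightarrow> real^'n)) set" where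
  "bundle_dom M i = (SIGMA p:chart_dom M i. tangent_space M p)"

definition induced_chart ::
    "('i, 'a, 'n::finite) manifold \<Rightarrow> 'i \<Rightarrow> 'a \<times> ('i \<Rightarrow> real^'n) \<Rightarrow> real^('n + 'n)" where
  "induced_chart M i = (\<lambda>(p, \<xi>). join (chart M i p) (\<xi> i))"

definition tangent_bundle ::
    "('i, 'a, 'n::finite) manifold \<Rightarrow> ('i, 'a \<times> ('i \<Rightarrow> real^'n), 'n + 'n) manifold" where
  "tangent_bundle M =
     \<lparr> mtop = topology_generated_by
         {bundle_dom M i \<inter> induced_chart M i -` W | i W. i \<in> indices M \<and> open W},
       indices = indices M,
       chart_dom = bundle_dom M,
       chart = induced_chart M \<rparr>"

definition synectic_metric ::
    "('i, 'n::finite) cov2field \<Rightarrow> ('i, 'n) cov2field \<Rightarrow> ('i, 'n + 'n) cov2field" where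
  "synectic_metric g a i z =
     (let x = base_part z; y = fibre_part z in
      \<chi> B A. case B of
        Inl k \<Rightarrow>
          (case A of
             Inl l \<Rightarrow> a i x $ k $ l + (\<Sum>s\<in>UNIV. y $ s * partial s (\<lambda>x. g i x $ k $ l) x)
           | Inr l \<Rightarrow> g i x $ k $ l)
      | Inr k \<Rightarrow>
          (case A of
             Inl l \<Rightarrow> g i x $ k $ l
           | Inr l \<Rightarrow> 0))"

definition vertical_lift :: "('i, 'n::finite) vfield \<Rightarrow> ('i, 'n + 'n) vfield" where
  "vertical_lift X i z = join 0 (X i (base_part z))"

end

theory Submission
  imports Defs
begin

text \<open>
  For a torsion-free connection \<open>D\<^sub>BZ\<^sub>A - D\<^sub>AZ\<^sub>B = \<partial>\<^sub>BZ\<^sub>A - \<partial>\<^sub>AZ\<^sub>B\<close>. The covector of the vertical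
  lift of \<open>X\<close> has components \<open>(X\<^sub>h, 0)\<close>, which do not depend on the fibre coordinates, so it is
  closed iff the covector of \<open>X\<close> is. The divergence always vanishes: the inverse metric has zero
  base-base block, so only index pairs \<open>(B, A)\<close> with a fibre index contribute. For these,
  \<open>\<partial>\<^sub>BZ\<^sub>A\<close> contributes nothing, and \<open>\<Gamma>\<^sup>C\<^sub>B\<^sub>AZ\<^sub>C\<close> is a combination of the Christoffel symbols of the
  first kind whose lowered index is a fibre index; these vanish, because the fibre-fibre block of
  the metric is zero and its mixed block does not depend on the fibre coordinates.
\<close>

section \<open>Christoffel symbols of the first kind and the curl of a covector\<close>

lemma is_levi_civita_levi_civita:
  fixes G :: "real^'n::finite \<Rightarrow> real^'n^'n"
  assumes "open S" "x \<in> S" "\<And>y. y \<in> S \<Longrightarrow> transpose (G y) = G y" "invertible (G x)"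
  shows "is_levi_civita G x (levi_civita G x)"
  using levi_civita_eq[where G = G, OF assms] by simp

text \<open>Koszul's argument: metric compatibility, written for three permutations of the indices,
  together with torsion-freeness isolates one lowered symbol. This form avoids the inverse
  metric.\<close>

lemma levi_civita_lowered:
  fixes G :: "real^'n::finite \<Rightarrow> real^'n^'n"
  assumes S: "open S" "x \<in> S" and sym: "\<And>y. y \<in> S \<Longrightarrow> transpose (G y) = G y"
    and inv: "invertible (G x)"
  shows "(\<Sum>c\<in>UNIV. levi_civita G x $ c $ j $ i * G x $ c $ m)
    = 1 / 2 * (partial j (\<lambda>x. G x $ i $ m) x + partial i (\<lambda>x. G x $ j $ m) x
        - partial m (\<lambda>x. G x $ j $ i) x)"
proof -
  have lc: "is_levi_civita G x (levi_civita G x)"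
    by (rule is_levi_civita_levi_civita[where G = G, OF assms])
  have Gsym: "G x $ j $ i = G x $ i $ j" for j i
    using sym[OF S(2)] by (metis transpose_def vec_lambda_beta)
  define L where "L m j i = (\<Sum>c\<in>UNIV. levi_civita G x $ c $ j $ i * G x $ c $ m)" for m j i
  have Lsym: "L m j i = L m i j" for m j i
    using lc unfolding L_def is_levi_civita_def by metis
  have "partial k (\<lambda>x. G x $ j $ i) x = L i k j + L j k i" for k j i
  proof -
    have "L j k i = (\<Sum>l\<in>UNIV. levi_civita G x $ l $ k $ i * G x $ j $ l)"
      unfolding L_def using Gsym by metis
    moreover have "partial k (\<lambda>x. G x $ j $ i) x
        - (\<Sum>l\<in>UNIV. levi_civita G x $ l $ k $ j * G x $ l $ i)
        - (\<Sum>l\<in>UNIV. levi_civita G x $ l $ k $ i * G x $ j $ l) = 0"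
      using lc unfolding is_levi_civita_def by blast
    ultimately show ?thesis
      by (simp add: L_def)
  qed
  \<comment> \<open>In the three permuted identities \<open>L i j m\<close> and
    \<open>L j i m\<close> cancel by symmetry, leaving \<open>L m j i\<close> twice.\<close>
  then show ?thesis
    unfolding L_def[symmetric] using Lsym[of m j i] Lsym[of j i m] Lsym[of i j m] by simp
qed

text \<open>The connection terms agree by torsion-freeness, so closedness becomes a condition on
  partial derivatives alone.\<close>

lemma cov_deriv_covector_curl:
  fixes G :: "real^'n::finite \<Rightarrow> real^'n^'n"
  assumes "open S" "x \<in> S" "\<And>y. y \<in> S \<Longrightarrow> transpose (G y) = G y" "invertible (G x)"
  shows "cov_deriv_covector G w b a x - cov_deriv_covector G w a b x
    = partial b (\<lambda>x. w x $ a) x - partial a (\<lambda>x. w x $ b) x"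
proof -
  have "levi_civita G x $ c $ b $ a = levi_civita G x $ c $ a $ b" for c
    using is_levi_civita_levi_civita[where G = G, OF assms] unfolding is_levi_civita_def by blast
  then show ?thesis
    by (simp add: cov_deriv_covector_def)
qed

section \<open>Splitting coordinates into base and fibre\<close>

lemma partial_const [simp]: "partial k (\<lambda>_. c) x = 0"
  by (simp add: partial_def)

lemma sum_UNIV_sum:
  fixes f :: "'m::finite + 'n::finite \<Rightarrow> 'b::comm_monoid_add"
  shows "sum f UNIV = (\<Sum>h\<in>UNIV. f (Inl h)) + (\<Sum>h\<in>UNIV. f (Inr h))"
  by (subst UNIV_Plus_UNIV[symmetric], subst sum.Plus) (auto simp: o_def)

lemma base_part_join [simp]: "base_part (join x y) = x"
  by (simp add: base_part_def join_def vec_eq_iff)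

lemma base_part_add_axis_Inl:
  "base_part (z + t *\<^sub>R axis (Inl k) 1) = base_part z + t *\<^sub>R axis k 1"
  by (simp add: base_part_def vec_eq_iff axis_def)

lemma base_part_add_axis_Inr: "base_part (z + t *\<^sub>R axis (Inr k) 1) = base_part z"
  by (simp add: base_part_def vec_eq_iff axis_def)

lemma partial_Inl_base_part [simp]:
  "partial (Inl k) (\<lambda>z. f (base_part z)) z = partial k f (base_part z)"
  by (simp add: partial_def base_part_add_axis_Inl)

lemma partial_Inr_base_part [simp]: "partial (Inr k) (\<lambda>z. f (base_part z)) z = 0"
  by (simp add: partial_def base_part_add_axis_Inr)

lemma open_base_part_vimage:
  fixes S :: "(real^'n::finite) set"
  assumes "open S"
  shows "open (base_part -` S)"
proof -
  have "continuous_on UNIV (base_part :: real^('n + 'n) \<Rightarrow> real^'n)"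
    unfolding base_part_def by (intro continuous_intros)
  with assms show ?thesis
    by (rule open_vimage)
qed

section \<open>Nondegeneracy and block structure of the synectic metric\<close>

lemma invertible_pos_def:
  fixes A :: "real^'n::finite^'n"
  assumes "\<And>v. v \<noteq> 0 \<Longrightarrow> v \<bullet> (A *v v) > 0"
  shows "invertible A"
proof -
  have "v = 0" if "A *v v = 0" for v
    using assms[of v] that by force
  then show ?thesis
    using matrix_left_invertible_ker invertible_left_inverse by metis
qed

lemma synectic_metric_simps [simp]:
  "synectic_metric g a i z $ Inl k $ Inr l = g i (base_part z) $ k $ l"
  "synectic_metric g a i z $ Inr k $ Inl l = g i (base_part z) $ k $ l"
  "synectic_metric g a i z $ Inr k $ Inr l = 0"
  by (simp_all add: synectic_metric_def Let_def)

lemma vertical_lift_simps [simp]: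
  "vertical_lift X i z $ Inl k = 0"
  "vertical_lift X i z $ Inr k = X i (base_part z) $ k"
  by (simp_all add: vertical_lift_def join_def)

text \<open>The vertical lift meets only the fibre columns of the metric, so \<open>a\<close> and
  the derivatives of \<open>g\<close> drop out.\<close>

lemma lower_vertical_lift [simp]:
  "lower (synectic_metric g a i) (vertical_lift X i) z $ Inl k
     = lower (g i) (X i) (base_part z) $ k"
  "lower (synectic_metric g a i) (vertical_lift X i) z $ Inr k = 0"
  by (simp_all add: lower_def matrix_vector_mult_def sum_UNIV_sum)

text \<open>The kernel is trivial by block elimination: the fibre rows force the base part to
  vanish, after which the base rows reduce to \<open>g\<close> acting on the fibre part.\<close>

lemma invertible_synectic_metric:
  fixes g a :: "('i, 'n::finite) cov2field"
  assumes "invertible (g i (base_part z))"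
  shows "invertible (synectic_metric g a i z)"
proof -
  have ker: "u = 0" if "g i (base_part z) *v u = 0" for u
    using assms that matrix_left_invertible_ker invertible_left_inverse by metis
  have "v = 0" if v: "synectic_metric g a i z *v v = 0" for v
  proof -
    have comp: "(\<Sum>B\<in>UNIV. synectic_metric g a i z $ A $ B * v $ B) = 0" for A
      using arg_cong[OF v, of "\<lambda>w. w $ A"] by (simp add: matrix_vector_mult_def)
    have "g i (base_part z) *v base_part v = 0"
      using comp[of "Inr _"]
      by (simp add: sum_UNIV_sum vec_eq_iff matrix_vector_mult_def base_part_def)
    then have "base_part v = 0"
      by (rule ker)
    then have Inl: "v $ Inl k = 0" for k
      by (simp add: vec_eq_iff base_part_def)
    have "g i (base_part z) *v fibre_part v = 0"
      using comp[of "Inl _"]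
      by (simp add: sum_UNIV_sum vec_eq_iff matrix_vector_mult_def fibre_part_def Inl)
    then have "fibre_part v = 0"
      by (rule ker)
    then have Inr: "v $ Inr k = 0" for k
      by (simp add: vec_eq_iff fibre_part_def)
    show "v = 0"
      unfolding vec_eq_iff using Inl Inr by (metis sumE zero_index)
  qed
  then show ?thesis
    using matrix_left_invertible_ker invertible_left_inverse by metis
qed

text \<open>In the product of the metric with its inverse, a fibre row against a base column gives
  an off-diagonal zero; since the fibre-fibre block is zero, it reads \<open>g\<close> times a
  column \<open>u\<close> of the wanted block.\<close>

lemma matrix_inv_synectic_metric_Inl_Inl:
  fixes g a :: "('i, 'n::finite) cov2field"
  assumes inv: "invertible (g i (base_part z))"
  shows "matrix_inv (synectic_metric g a i z) $ Inl k $ Inl l = 0"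
proof -
  let ?G = "synectic_metric g a i z" and ?H = "matrix_inv (synectic_metric g a i z)"
  define u where "u = (\<chi> m. ?H $ Inl m $ Inl l)"
  have "?G ** ?H = mat 1"
    using someI_ex[OF invertible_synectic_metric[where g = g and i = i, OF inv, unfolded invertible_def]]
    unfolding matrix_inv_def by blast
  then have "(?G ** ?H) $ Inr m $ Inl l = 0" for m
    by (simp add: mat_def)
  then have "g i (base_part z) *v u = 0"
    by (simp add: matrix_matrix_mult_def sum_UNIV_sum vec_eq_iff matrix_vector_mult_def u_def)
  then have "u = 0"
    using inv matrix_left_invertible_ker invertible_left_inverse by metis
  then show ?thesis
    by (simp add: u_def vec_eq_iff)
qed

text \<open>The metric contains derivatives of \<open>g\<close>, so symmetry of \<open>g\<close> is
  required on an open set, while that of \<open>a\<close> is required only at the point.\<close>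

lemma transpose_synectic_metric:
  fixes g a :: "('i, 'n::finite) cov2field"
  assumes S: "open S" "base_part z \<in> S"
    and g: "\<And>y. y \<in> S \<Longrightarrow> transpose (g i y) = g i y"
    and a: "transpose (a i (base_part z)) = a i (base_part z)"
  shows "transpose (synectic_metric g a i z) = synectic_metric g a i z" (is "transpose ?G = ?G")
proof -
  have g_sym: "g i y $ k $ l = g i y $ l $ k" if "y \<in> S" for y k l
    using arg_cong[OF g[OF that], of "\<lambda>A. A $ k $ l"] by (simp add: transpose_def)
  have a_sym: "a i (base_part z) $ k $ l = a i (base_part z) $ l $ k" for k l
    using arg_cong[OF a, of "\<lambda>A. A $ k $ l"] by (simp add: transpose_def)
  have partial_sym: "partial s (\<lambda>x. g i x $ k $ l) (base_part z)
      = partial s (\<lambda>x. g i x $ l $ k) (base_part z)" for s k l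
    by (rule partial_cong[OF S]) (rule g_sym)
  have "?G $ A $ B = ?G $ B $ A" for A B
  proof (cases A; cases B)
    fix k l
    assume "A = Inl k" "B = Inl l"
    then show ?thesis
      by (simp add: synectic_metric_def Let_def a_sym[of k l] partial_sym[of _ k l])
  qed (simp_all add: g_sym[OF S(2)])
  then show ?thesis
    by (simp add: vec_eq_iff transpose_def)
qed

section \<open>Chart images of the tangent bundle\<close>

lemma chart_image_tangent_bundle_subset:
  assumes "z \<in> chart_image (tangent_bundle M) i"
  shows "base_part z \<in> chart_image M i"
  using assms
  by (auto simp: chart_image_def tangent_bundle_def bundle_dom_def induced_chart_def)

text \<open>Provides a point over each base point at which closedness on the bundle can be
  evaluated.\<close>

lemma zero_section_in_chart_image:
  assumes "x \<in> chart_image M i"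
  shows "join x 0 \<in> chart_image (tangent_bundle M) i"
proof -
  obtain p where p: "p \<in> chart_dom M i" "x = chart M i p"
    using assms by (auto simp: chart_image_def)
  have "(\<lambda>_. 0) \<in> tangent_space M p"
    by (simp add: tangent_space_def)
  then have "(p, \<lambda>_. 0) \<in> bundle_dom M i"
    using p by (simp add: bundle_dom_def)
  moreover have "join x 0 = induced_chart M i (p, \<lambda>_. 0)"
    by (simp add: induced_chart_def p)
  ultimately show ?thesis
    by (auto simp: chart_image_def tangent_bundle_def)
qed

section \<open>Vanishing of the divergence\<close>

text \<open>The excluded base-base pairs are those killed by the inverse metric. For the others,
  each metric derivative in a symbol with lowered fibre index is that of a zero entry or a fibre
  derivative of the mixed block.\<close>

lemma cov_deriv_vertical_lift_fibre:
  fixes g a :: "('i, 'n::finite) cov2field" and X :: "('i, 'n) vfield"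
  assumes S: "open S" "z \<in> S"
    and sym: "\<And>y. y \<in> S \<Longrightarrow> transpose (synectic_metric g a i y) = synectic_metric g a i y"
    and inv: "invertible (synectic_metric g a i z)"
    and fibre: "\<not> (isl B \<and> isl A)"
  shows "cov_deriv_covector (synectic_metric g a i)
    (lower (synectic_metric g a i) (vertical_lift X i)) B A z = 0"
proof -
  let ?G = "synectic_metric g a i" and ?V = "vertical_lift X i"
  let ?\<Gamma> = "levi_civita ?G z"
  have "partial B (\<lambda>z. ?G z $ A $ Inr d) z + partial A (\<lambda>z. ?G z $ B $ Inr d) z
      - partial (Inr d) (\<lambda>z. ?G z $ B $ A) z = 0" for d
    using fibre by (cases B; cases A)
      (simp_all add: partial_Inr_base_part[of _ "\<lambda>x. g i x $ _ $ _"])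
  then have lowered: "(\<Sum>C\<in>UNIV. ?\<Gamma> $ C $ B $ A * ?G z $ C $ Inr d) = 0" for d
    by (simp only: levi_civita_lowered[where G = ?G, OF S sym inv] mult_zero_right)
  \<comment> \<open>The metric is moved from \<open>?V\<close> onto the connection. Base indices
    \<open>D\<close> then drop because \<open>?V\<close> vanishes there, fibre indices by
    \<open>lowered\<close>.\<close>
  have "(\<Sum>C\<in>UNIV. ?\<Gamma> $ C $ B $ A * lower ?G ?V z $ C)
      = (\<Sum>D\<in>UNIV. (\<Sum>C\<in>UNIV. ?\<Gamma> $ C $ B $ A * ?G z $ C $ D) * ?V z $ D)"
    by (simp add: lower_def matrix_vector_mult_def sum_distrib_left sum_distrib_right mult.assoc)
      (rule sum.swap)
  also have "\<dots> = 0"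
    by (simp add: sum_UNIV_sum[of "\<lambda>D. _ D * ?V z $ D"] lowered)
  finally have "(\<Sum>C\<in>UNIV. ?\<Gamma> $ C $ B $ A * lower ?G ?V z $ C) = 0" .
  moreover have "partial B (\<lambda>z. lower ?G ?V z $ A) z = 0"
    using fibre by (cases B; cases A)
      (simp_all add: partial_Inr_base_part[of _ "\<lambda>x. lower (g i) (X i) x $ _"])
  ultimately show ?thesis
    by (simp add: cov_deriv_covector_def)
qed

section \<open>Closedness on base and bundle, and harmonicity\<close>

theorem theorem2:
  fixes M :: "('i, 'a, 'n::finite) manifold"
    and g a :: "('i, 'n) cov2field"
    and X :: "('i, 'n) vfield"
  assumes "smooth_manifold M"
    and "riemannian_metric M g"
    and "cov2_tensor_field M a" and "symmetric_cov2 M a"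
    and "vector_field M X"
  shows "harmonic_vector_field (tangent_bundle M) (synectic_metric g a) (vertical_lift X)
     \<longleftrightarrow> closed_vector_field M g X"
proof -
  let ?T = "tangent_bundle M" and ?G = "synectic_metric g a" and ?V = "vertical_lift X"
  let ?w = "\<lambda>i. lower (g i) (X i)" and ?W = "\<lambda>i. lower (?G i) (?V i)"
  have indices: "indices ?T = indices M"
    by (simp add: tangent_bundle_def)
  have opn: "open (chart_image M i)" if "i \<in> indices M" for i
    using assms(1) that by (auto simp: smooth_manifold_def)
  have g_sym: "transpose (g i x) = g i x" if "i \<in> indices M" "x \<in> chart_image M i" for i x
    using assms(2) that by (auto simp: riemannian_metric_def symmetric_cov2_def)
  have a_sym: "transpose (a i x) = a i x" if "i \<in> indices M" "x \<in> chart_image M i" for i x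
    using assms(4) that by (auto simp: symmetric_cov2_def)
  have g_inv: "invertible (g i x)" if "i \<in> indices M" "x \<in> chart_image M i" for i x
    using assms(2) that by (intro invertible_pos_def) (auto simp: riemannian_metric_def)
  \<comment> \<open>The bundle identities are proved on the full preimage of a base chart image. It
    contains the bundle chart image, and its openness follows from continuity of
    \<open>base_part\<close>.\<close>
  have G_opn: "open (base_part -` chart_image M i)" if "i \<in> indices M" for i
    using open_base_part_vimage opn that by blast
  have G_sym: "transpose (?G i z) = ?G i z"
    if "i \<in> indices M" "z \<in> base_part -` chart_image M i" for i z
    using that by (intro transpose_synectic_metric[OF opn[of i]] g_sym a_sym) auto
  have G_inv: "invertible (?G i z)"
    if "i \<in> indices M" "base_part z \<in> chart_image M i" for i z
    using that by (intro invertible_synectic_metric g_inv)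
  have base_curl: "cov_deriv_covector (g i) (?w i) k l x - cov_deriv_covector (g i) (?w i) l k x
      = partial k (\<lambda>x. ?w i x $ l) x - partial l (\<lambda>x. ?w i x $ k) x"
    if "i \<in> indices M" "x \<in> chart_image M i" for i x k l
    using that by (intro cov_deriv_covector_curl[OF opn] g_sym g_inv)
  have bundle_curl:
    "cov_deriv_covector (?G i) (?W i) B A z - cov_deriv_covector (?G i) (?W i) A B z
      = partial B (\<lambda>z. ?W i z $ A) z - partial A (\<lambda>z. ?W i z $ B) z"
    if "i \<in> indices M" "base_part z \<in> chart_image M i" for i z B A
    using that by (intro cov_deriv_covector_curl[OF G_opn] G_sym G_inv) auto
  have partial_W: "partial (Inl k) (\<lambda>z. ?W i z $ Inl l) z = partial k (\<lambda>x. ?w i x $ l) (base_part z)"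
    "partial (Inr k) (\<lambda>z. ?W i z $ Inl l) z = 0"
    "partial B (\<lambda>z. ?W i z $ Inr l) z = 0" for i k l z B
    by (simp_all add: partial_Inl_base_part[of _ "\<lambda>x. ?w i x $ l"]
      partial_Inr_base_part[of _ "\<lambda>x. ?w i x $ l"])
  have closed: "closed_vector_field ?T ?G ?V \<longleftrightarrow> closed_vector_field M g X"
  proof
    assume lift: "closed_vector_field ?T ?G ?V"
    show "closed_vector_field M g X"
      unfolding closed_vector_field_def
    proof (intro ballI allI)
      fix i x l k
      assume i: "i \<in> indices M" and x: "x \<in> chart_image M i"
      have "join x 0 \<in> chart_image ?T i"
        by (rule zero_section_in_chart_image[OF x])
      then have "cov_deriv_covector (?G i) (?W i) (Inl k) (Inl l) (join x 0)
          - cov_deriv_covector (?G i) (?W i) (Inl l) (Inl k) (join x 0) = 0"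
        using lift i indices by (simp add: closed_vector_field_def)
      then show "cov_deriv_covector (g i) (?w i) k l x - cov_deriv_covector (g i) (?w i) l k x = 0"
        unfolding base_curl[OF i x] using bundle_curl[OF i, of "join x 0"] x
        by (simp only: partial_W base_part_join)
    qed
  next
    assume base: "closed_vector_field M g X"
    show "closed_vector_field ?T ?G ?V"
      unfolding closed_vector_field_def indices
    proof (intro ballI allI)
      fix i z A B
      assume i: "i \<in> indices M" and "z \<in> chart_image ?T i"
      then have z: "base_part z \<in> chart_image M i"
        by (simp add: chart_image_tangent_bundle_subset)
      have "partial k (\<lambda>x. ?w i x $ l) (base_part z) = partial l (\<lambda>x. ?w i x $ k) (base_part z)"
        for k l
        using base i z base_curl[OF i z, of k l] by (simp add: closed_vector_field_def)
      \<comment> \<open>Two base indices give the curl on the base; in every other case both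
        derivatives vanish.\<close>
      then show "cov_deriv_covector (?G i) (?W i) B A z - cov_deriv_covector (?G i) (?W i) A B z = 0"
        unfolding bundle_curl[OF i z] by (cases A; cases B) (simp_all only: partial_W diff_self)
    qed
  qed
  have div: "(\<Sum>B\<in>UNIV. \<Sum>A\<in>UNIV. matrix_inv (?G i z) $ B $ A *
      cov_deriv_covector (?G i) (?W i) B A z) = 0"
    if i: "i \<in> indices M" and z: "base_part z \<in> chart_image M i" for i z
  proof (intro sum.neutral ballI)
    fix B A :: "'n + 'n"
    show "matrix_inv (?G i z) $ B $ A * cov_deriv_covector (?G i) (?W i) B A z = 0"
    proof (cases "isl B \<and> isl A")
      case True
      then show ?thesis
        using matrix_inv_synectic_metric_Inl_Inl[where g = g and i = i, OF g_inv[OF i z]]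
        by (auto simp: isl_def)
    next
      case False
      then show ?thesis
        using cov_deriv_vertical_lift_fibre[OF G_opn[OF i] _ G_sym[OF i] G_inv[OF i z]] z by simp
    qed
  qed
  have "(\<Sum>B\<in>UNIV. \<Sum>A\<in>UNIV. matrix_inv (?G i z) $ B $ A *
      cov_deriv_covector (?G i) (?W i) B A z) = 0"
    if "i \<in> indices M" "z \<in> chart_image ?T i" for i z
    using that by (intro div chart_image_tangent_bundle_subset)
  then show ?thesis
    unfolding harmonic_vector_field_def indices closed by simp
qed

end
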